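(* Let $G$ be a finite simple graph such that every connected induced subgraph of $G$ is geodetic (i.e. $G$ belongs to the maximal hereditary subclass $\lfloor\mathcal G\rfloor$ of the class of geodetic graphs). Then every block of $G$ is either a complete graph or a cycle of odd length.
   Context: A geodesic is a shortest path between two vertices; a graph is geodetic if between any two vertices there is exactly one geodesic. The class $\lfloor\mathcal G\rfloor$ is the largest class of graphs closed under taking induced subgraphs all of whose members have only geodetic connected components; equivalently, the graphs all of whose connected induced subgraphs are geodetic. A block is a maximal connected subgraph without a cut vertex. *)

theory Defs
  imports "Graph_Theory.Graph_Theory"
begin

text \<open>
  Finite simple graphs are symmetric loop-free digraphs without parallel arcs
  (locale \<^locale>\<open>graph\<close>): an undirected edge is a pair of opposite arcs.
\<close>

definition geodesic :: "('a,'b) pre_digraph \<Rightarrow> 'a \<Rightarrow> 'b awalk \<Rightarrow> 'a \<Rightarrow> bool" where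
  "geodesic G u p v \<longleftrightarrow>
     pre_digraph.apath G u p v \<and> (\<forall>q. pre_digraph.apath G u q v \<longrightarrow> length p \<le> length q)"

text \<open>
  Paths are arc lists from \<open>u\<close> to \<open>v\<close>. Without parallel arcs this is the same as counting
  vertex sequences, and reversal identifies the geodesics of \<open>(u, v)\<close> with those of \<open>(v, u)\<close>.
\<close>

definition geodetic :: "('a,'b) pre_digraph \<Rightarrow> bool" where
  "geodetic G \<longleftrightarrow> (\<forall>u\<in>verts G. \<forall>v\<in>verts G. \<exists>!p. geodesic G u p v)"

text \<open>
  A cut vertex separates two other vertices of its component. Stating this by reachability
  avoids the empty graph, which is not \<^const>\<open>Digraph_Component.connected\<close>: the vertex of
  a one-vertex graph is not a cut vertex.
\<close>

definition cut_vertex :: "('a,'b) pre_digraph \<Rightarrow> 'a \<Rightarrow> bool" where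
  "cut_vertex G c \<longleftrightarrow> c \<in> verts G \<and>
     (\<exists>u\<in>verts G - {c}. \<exists>v\<in>verts G - {c}.
        u \<rightarrow>\<^sup>*\<^bsub>G\<^esub> v \<and> \<not> u \<rightarrow>\<^sup>*\<^bsub>pre_digraph.del_vert G c\<^esub> v)"

text \<open>
  \<^const>\<open>subgraph\<close> alone would allow a single arc of an edge to be dropped; requiring
  \<^const>\<open>Digraph.graph\<close> restricts to undirected subgraphs.
\<close>

definition block :: "('a,'b) pre_digraph \<Rightarrow> ('a,'b) pre_digraph \<Rightarrow> bool" where
  "block B G \<longleftrightarrow>
     pre_digraph.max_subgraph G
       (\<lambda>H. Digraph.graph H \<and> Digraph_Component.connected H \<and> (\<nexists>c. cut_vertex H c)) B"

text \<open>
  The cycle graph on \<open>n\<close> vertices. In a symmetric digraph the closed walk \<open>a, b, a\<close> counts as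
  a \<^const>\<open>pre_digraph.cycle\<close>, hence the bound on \<open>n\<close>. All vertices lie on \<open>p\<close>, and
  every arc belongs to \<open>p\<close> or is the reverse of an arc of \<open>p\<close>.
\<close>

definition cycle_digraph :: "nat \<Rightarrow> ('a,'b) pre_digraph \<Rightarrow> bool" where
  "cycle_digraph n G \<longleftrightarrow> Digraph.graph G \<and> 3 \<le> n \<and>
     (\<exists>p. pre_digraph.cycle G p \<and> length p = n \<and>
        verts G = tail G ` set p \<and> arcs_ends G = (arc_to_ends G ` set p)\<^sup>s)"

end

theory Submission
  imports Defs
begin

text \<open>
  A block is an induced subgraph, hence a 2-connected graph without induced even cycles and induced
  theta graphs: two of the three paths of a theta graph have equal parity, so they form an even
  cycle, and the middle of one of them has two geodesics to an antipodal vertex on the other, one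
  through each pole; the third path joins the poles and gives no shortcut.

  If the block has a triangle, let \<open>K\<close> be a maximal clique containing it. Were there a vertex
  outside \<open>K\<close>, a shortest ear of \<open>K\<close>, the edge between its ends and a suitable third vertex of \<open>K\<close>
  would form an induced theta graph. If there is no triangle and the block has more than two
  vertices, a shortest cycle is induced and has odd length at least five. Were there a vertex
  outside, a shortest ear of the cycle would have length at least three by minimality of the cycle,
  and together they would form an induced theta graph.
\<close>

section \<open>Theta graphs\<close>

text \<open>
  The function \<open>f\<close> bounds distances from below: it changes by at most one along an edge, so a walk
  of length \<open>n\<close> on which it grows by \<open>n\<close> is a geodesic. This avoids computing distances.
\<close>

definition unique_geodesics_on :: "'a rel \<Rightarrow> 'a set \<Rightarrow> bool" where
  "unique_geodesics_on E S \<longleftrightarrow>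
     (\<forall>(f :: 'a \<Rightarrow> nat) n x y.
        (\<forall>a\<in>S. \<forall>b\<in>S. (a, b) \<in> E \<longrightarrow> f b \<le> Suc (f a)) \<longrightarrow>
        (\<forall>k\<le>n. x k \<in> S \<and> y k \<in> S) \<longrightarrow>
        (\<forall>k<n. (x k, x (Suc k)) \<in> E \<and> (y k, y (Suc k)) \<in> E) \<longrightarrow>
        x 0 = y 0 \<longrightarrow> x n = y n \<longrightarrow> f (x n) = f (x 0) + n \<longrightarrow>
        (\<forall>k\<le>n. x k = y k))"

lemma unique_geodesics_onD:
  fixes f :: "'a \<Rightarrow> nat"
  assumes "unique_geodesics_on E S"
    and "\<And>a b. a \<in> S \<Longrightarrow> b \<in> S \<Longrightarrow> (a, b) \<in> E \<Longrightarrow> f b \<le> Suc (f a)"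
    and "\<And>k. k \<le> n \<Longrightarrow> x k \<in> S" "\<And>k. k \<le> n \<Longrightarrow> y k \<in> S"
    and "\<And>k. k < n \<Longrightarrow> (x k, x (Suc k)) \<in> E" "\<And>k. k < n \<Longrightarrow> (y k, y (Suc k)) \<in> E"
    and "x 0 = y 0" "x n = y n" "f (x n) = f (x 0) + n" "k \<le> n"
  shows "x k = y k"
  using assms(1)[unfolded unique_geodesics_on_def, rule_format, of f n x y k] assms(2-) by blast

text \<open>The empty set is connected in this sense, so deleting the vertex of a one-vertex graph
  needs no special case.\<close>

definition connected_on :: "'a rel \<Rightarrow> 'a set \<Rightarrow> bool" where
  "connected_on E S \<longleftrightarrow> (\<forall>a\<in>S. \<forall>b\<in>S. (a, b) \<in> (E \<inter> S \<times> S)\<^sup>*)"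

text \<open>
  An induced union of internally disjoint paths between two poles: a cycle for two paths, a theta
  graph for three.
\<close>

locale theta_graph =
  fixes E :: "'a rel" and I :: "nat set" and l :: "nat \<Rightarrow> nat" and p :: "nat \<Rightarrow> nat \<Rightarrow> 'a"
    and u v :: 'a
  assumes sym: "sym E"
    and start: "i \<in> I \<Longrightarrow> p i 0 = u"
    and finish: "i \<in> I \<Longrightarrow> p i (l i) = v"
    and pos: "i \<in> I \<Longrightarrow> 0 < l i"
    and disjoint: "\<lbrakk>i \<in> I; j \<in> I; k \<le> l i; m \<le> l j; p i k = p j m\<rbrakk> \<Longrightarrow>
          i = j \<and> k = m \<or> k = 0 \<and> m = 0 \<or> k = l i \<and> m = l j"
    and step: "\<lbrakk>i \<in> I; k < l i\<rbrakk> \<Longrightarrow> (p i k, p i (Suc k)) \<in> E"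
    and induced: "\<lbrakk>i \<in> I; j \<in> I; k \<le> l i; m \<le> l j; (p i k, p j m) \<in> E\<rbrakk> \<Longrightarrow>
          \<exists>i'\<in>I. \<exists>k'<l i'. p i k = p i' k' \<and> p j m = p i' (Suc k')
                        \<or> p i k = p i' (Suc k') \<and> p j m = p i' k'"
begin

definition support :: "'a set" where
  "support = (\<Union>i\<in>I. p i ` {..l i})"

lemma support_I: "i \<in> I \<Longrightarrow> k \<le> l i \<Longrightarrow> p i k \<in> support"
  by (auto simp: support_def)

lemma connected_on_support: "connected_on E support"
proof -
  have to_u: "(u, p i k) \<in> (E \<inter> support \<times> support)\<^sup>*" if "i \<in> I" "k \<le> l i" for i k
    using that(2)
  proof (induction k)
    case 0
    then show ?case using start[OF that(1)] by simp
  next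
    case (Suc k)
    moreover have "(p i k, p i (Suc k)) \<in> E \<inter> support \<times> support"
      using Suc.prems that(1) step support_I by simp
    ultimately show ?case by (meson Suc_leD rtrancl.rtrancl_into_rtrancl)
  qed
  have "sym ((E \<inter> support \<times> support)\<^sup>*)"
    by (rule sym_rtrancl) (use sym in \<open>auto simp: sym_def\<close>)
  then show ?thesis
    unfolding connected_on_def using to_u
    by (auto simp: support_def) (meson rtrancl_trans symE)
qed

text \<open>Paths \<open>s\<close> and \<open>t\<close> form an even cycle, in which a middle vertex
  of \<open>s\<close> has two routes of equal length to its antipode on \<open>t\<close>. A further
  path only joins the poles, whose distances from the middle vertex along \<open>s\<close> differ by
  at most one, so it cannot shorten either route. The bound \<open>2 \<le> l s\<close> keeps the
  middle vertex away from the poles.\<close>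

lemma not_unique_geodesics_on_support:
  assumes s: "s \<in> I" and t: "t \<in> I" and "s \<noteq> t" and ev: "even (l s + l t)" and two: "2 \<le> l s"
  shows "\<not> unique_geodesics_on E support"
proof
  assume uniq: "unique_geodesics_on E support"
  define j where "j = l s div 2"
  define h where "h = (l s + l t) div 2"
  \<comment> \<open>The distance from the middle vertex \<open>p s j\<close> of path \<open>s\<close>; by parity some vertex of path \<open>t\<close> is
    equally far from it in both directions around the cycle formed by the two paths.\<close>
  define g where "g i k = (if i = s then (k - j) + (j - k) else min (j + k) (l s - j + (l i - k)))"
    for i k :: nat
  have j: "1 \<le> j" "j \<le> l s - j" "l s - j \<le> Suc j" "j \<le> l s"
    using two by (auto simp: j_def)
  have h: "2 * h = l s + l t" "j \<le> h" "l s - j \<le> h" "h - j \<le> l t"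
      "l t - (h - (l s - j)) = h - j" "h - (l s - j) \<le> l t"
  proof -
    define e where "e = l s mod 2"
    have e: "l s = 2 * j + e" "e < 2" unfolding j_def e_def by auto
    then have "even (l t + e)" using ev by auto
    define m where "m = l t div 2"
    have "l t mod 2 = e" using \<open>even (l t + e)\<close> e(2) by presburger
    then have lt: "l t = 2 * m + e" unfolding m_def by (metis mult_div_mod_eq)
    then have "l s + l t = 2 * (j + m + e)" using e lt by simp
    then have "h = j + m + e" by (simp add: h_def)
    then show "2 * h = l s + l t" "j \<le> h" "l s - j \<le> h" "h - j \<le> l t"
      "l t - (h - (l s - j)) = h - j" "h - (l s - j) \<le> l t"
      using e lt by simp_all
  qed
  \<comment> \<open>At the poles the formulas of all paths agree, because
    \<open>j \<le> l s - j \<le> Suc j\<close> and no path has length zero.\<close>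
  have g_start: "g i 0 = j" if "i \<in> I" for i
    using j by (auto simp: g_def)
  have g_finish: "g i (l i) = l s - j" if "i \<in> I" for i
    using j pos[OF that] by (auto simp: g_def)
  have g_eq: "g i k = g i' k'"
    if "i \<in> I" "i' \<in> I" "k \<le> l i" "k' \<le> l i'" "p i k = p i' k'" for i i' k k'
    using disjoint[OF that] g_start g_finish that by metis
  \<comment> \<open>A pole lies on every path, so a vertex may have several positions;
    \<open>g_eq\<close> makes the choice harmless.\<close>
  define f where "f x = (SOME c. \<exists>i\<in>I. \<exists>k\<le>l i. x = p i k \<and> c = g i k)" for x
  have f: "f (p i k) = g i k" if "i \<in> I" "k \<le> l i" for i k
  proof -
    have "\<exists>i'\<in>I. \<exists>k'\<le>l i'. p i k = p i' k' \<and> f (p i k) = g i' k'"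
      unfolding f_def by (rule someI_ex) (use that in blast)
    then show ?thesis using g_eq that by metis
  qed
  have g_step: "g i (Suc k) \<le> Suc (g i k)" "g i k \<le> Suc (g i (Suc k))" if "k < l i" for i k
    using that by (auto simp: g_def)
  have f_lip: "f b \<le> Suc (f a)" if "a \<in> support" "b \<in> support" "(a, b) \<in> E" for a b
  proof -
    obtain i k i' k' where "i \<in> I" "k \<le> l i" "a = p i k" "i' \<in> I" "k' \<le> l i'" "b = p i' k'"
      using \<open>a \<in> support\<close> \<open>b \<in> support\<close> by (auto simp: support_def)
    then obtain i k where "i \<in> I" "k < l i"
      "a = p i k \<and> b = p i (Suc k) \<or> a = p i (Suc k) \<and> b = p i k"
      using induced \<open>(a, b) \<in> E\<close> by meson
    then show ?thesis using f[of i k] f[of i "Suc k"] g_step by auto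
  qed
  \<comment> \<open>From \<open>p s j\<close>, the walk \<open>x\<close> passes \<open>u\<close> and
    enters path \<open>t\<close> from its start, while \<open>y\<close> passes \<open>v\<close> and
    enters \<open>t\<close> from its end. After \<open>h\<close> steps both are at
    \<open>p t (h - j)\<close>.\<close>
  define x where "x k = (if k \<le> j then p s (j - k) else p t (k - j))" for k
  define y where "y k = (if k \<le> l s - j then p s (j + k) else p t (l t - (k - (l s - j))))" for k
  have x: "x k \<in> support" if "k \<le> h" for k
    using that h j s t by (auto simp: x_def intro!: support_I)
  have y: "y k \<in> support" if "k \<le> h" for k
    using that h j s t by (auto simp: y_def intro!: support_I)
  have x_step: "(x k, x (Suc k)) \<in> E" if "k < h" for k
  proof -
    consider "k < j" | "k = j" | "j < k" by linarith
    then show ?thesis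
    proof cases
      case 1
      then have "(p s (j - Suc k), p s (Suc (j - Suc k))) \<in> E" using j by (intro step s) auto
      then show ?thesis using 1 sym by (auto simp: x_def Suc_diff_Suc sym_def)
    next
      case 2
      then show ?thesis using step[OF t, of 0] pos[OF t] start[OF s] start[OF t] by (auto simp: x_def)
    next
      case 3
      then show ?thesis using step[OF t, of "k - j"] that h by (auto simp: x_def Suc_diff_le)
    qed
  qed
  have y_step: "(y k, y (Suc k)) \<in> E" if "k < h" for k
  proof -
    consider "k < l s - j" | "l s - j \<le> k" by linarith
    then show ?thesis
    proof cases
      case 1
      then show ?thesis using step[OF s, of "j + k"] by (auto simp: y_def)
    next
      case 2
      define d where "d = k - (l s - j)"
      have d: "d < l t" using that 2 h unfolding d_def by linarith
      have "y k = p t (l t - d)"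
        using 2 d j finish[OF s] finish[OF t] by (auto simp: y_def d_def)
      moreover have "y (Suc k) = p t (l t - Suc d)"
        using 2 by (auto simp: y_def d_def Suc_diff_le)
      moreover have "(p t (l t - Suc d), p t (Suc (l t - Suc d))) \<in> E"
        using d by (intro step t) auto
      ultimately show ?thesis using d sym by (auto simp: Suc_diff_Suc sym_def)
    qed
  qed
  have x0: "x 0 = p s j" and y0: "y 0 = p s j" by (auto simp: x_def y_def)
  have xh: "x h = p t (h - j)"
    using h j start[OF s] start[OF t] by (auto simp: x_def)
  have yh: "y h = p t (h - j)"
    using h j finish[OF s] finish[OF t] by (auto simp: y_def)
  have "g t (h - j) = h" using \<open>s \<noteq> t\<close> h j by (auto simp: g_def)
  then have "f (x h) = f (x 0) + h"
    using f[OF t h(4)] f[OF s j(4)] by (simp add: xh x0 g_def)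
  \<comment> \<open>After \<open>j\<close> steps \<open>x\<close> is at the pole \<open>u\<close>,
    whereas \<open>y\<close> is still on path \<open>s\<close>, at position
    \<open>j + j > 0\<close>.\<close>
  then have "x j = y j"
    using unique_geodesics_onD[OF uniq, of f h x y j] f_lip x y x_step y_step x0 y0 xh yh h by auto
  then have "p s 0 = p s (j + j)" using j by (auto simp: x_def y_def)
  moreover have "j + j \<le> l s" using j by linarith
  ultimately show False using disjoint[OF s s, of 0 "j + j"] j two by auto
qed

text \<open>Two of three numbers have equal parity. At most one path is a single edge, so one of the
  two chosen paths has an inner vertex to start from.\<close>

lemma not_unique_geodesics_on_three_paths:
  assumes "I = {0, 1, 2}" and simple: "\<And>i j. \<lbrakk>i \<in> I; j \<in> I; i \<noteq> j\<rbrakk> \<Longrightarrow> 2 \<le> l i \<or> 2 \<le> l j"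
  shows "\<not> unique_geodesics_on E support"
proof -
  have "even (l 0 + l 1) \<or> even (l 0 + l 2) \<or> even (l 1 + l 2)" by auto
  then obtain i j where "i \<in> I" "j \<in> I" "i \<noteq> j" "even (l i + l j)"
    using \<open>I = {0, 1, 2}\<close> by (metis insertI1 insertI2 zero_neq_numeral one_eq_numeral_iff num.distinct(1))
  then show ?thesis
    using simple not_unique_geodesics_on_support[of i j] not_unique_geodesics_on_support[of j i]
    by (auto simp: add.commute)
qed

end

section \<open>Ears\<close>

text \<open>
  The ends of an ear may be adjacent to each other, and the inner vertex of an ear of length two may
  have further neighbours in \<open>S\<close>.
\<close>

definition induced_ear :: "'a rel \<Rightarrow> 'a set \<Rightarrow> (nat \<Rightarrow> 'a) \<Rightarrow> nat \<Rightarrow> bool" where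
  "induced_ear E S q n \<longleftrightarrow> q 0 \<in> S \<and> q n \<in> S \<and> q 0 \<noteq> q n \<and> 2 \<le> n \<and> inj_on q {..n}
     \<and> (\<forall>k<n. (q k, q (Suc k)) \<in> E)
     \<and> (\<forall>k. 0 < k \<longrightarrow> k < n \<longrightarrow> q k \<notin> S)
     \<and> (\<forall>i k. i < k \<longrightarrow> k \<le> n \<longrightarrow> (q i, q k) \<in> E \<longrightarrow> k = Suc i \<or> i = 0 \<and> k = n)
     \<and> (\<forall>k z. 0 < k \<longrightarrow> k < n \<longrightarrow> z \<in> S \<longrightarrow> (q k, z) \<in> E \<longrightarrow> z = q 0 \<or> z = q n \<or> n = 2)"

lemma induced_earD:
  assumes "induced_ear E S q n"
  shows "q 0 \<in> S" "q n \<in> S" "q 0 \<noteq> q n" "2 \<le> n" "inj_on q {..n}"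
    "\<And>k. k < n \<Longrightarrow> (q k, q (Suc k)) \<in> E"
    "\<And>k. \<lbrakk>0 < k; k < n\<rbrakk> \<Longrightarrow> q k \<notin> S"
    "\<And>i k. \<lbrakk>i < k; k \<le> n; (q i, q k) \<in> E\<rbrakk> \<Longrightarrow> k = Suc i \<or> i = 0 \<and> k = n"
    "\<And>k z. \<lbrakk>0 < k; k < n; z \<in> S; (q k, z) \<in> E\<rbrakk> \<Longrightarrow> z = q 0 \<or> z = q n \<or> n = 2"
  using assms unfolding induced_ear_def by blast+

text \<open>An induced subgraph is represented by its vertex set alone: both
  \<open>connected_on E S\<close> and \<open>unique_geodesics_on E S\<close> look at
  \<open>E\<close> only between members of \<open>S\<close>.\<close>

locale hereditarily_geodetic_block =
  fixes V :: "'a set" and E :: "'a rel"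
  assumes finite_V: "finite V" and sym: "sym E" and irrefl: "irrefl E" and E_V: "E \<subseteq> V \<times> V"
    and connected: "connected_on E V"
    and no_cut: "c \<in> V \<Longrightarrow> connected_on E (V - {c})"
    and unique: "\<lbrakk>S \<subseteq> V; connected_on E S\<rbrakk> \<Longrightarrow> unique_geodesics_on E S"
begin

lemma E_sym: "(a, b) \<in> E \<Longrightarrow> (b, a) \<in> E"
  using sym by (auto simp: sym_def)

lemma E_neq: "(a, b) \<in> E \<Longrightarrow> a \<noteq> b"
  using irrefl by (auto simp: irrefl_def)

lemma E_verts: "(a, b) \<in> E \<Longrightarrow> a \<in> V" "(a, b) \<in> E \<Longrightarrow> b \<in> V"
  using E_V by auto

lemma theta_graph_False:
  assumes "theta_graph E {0, 1, 2} l p u v"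
    and "\<And>i j. \<lbrakk>i \<in> {0, 1, 2}; j \<in> {0, 1, 2}; i \<noteq> j\<rbrakk> \<Longrightarrow> 2 \<le> l i \<or> 2 \<le> l j"
    and "\<And>i k. \<lbrakk>i \<in> {0, 1, 2}; k \<le> l i\<rbrakk> \<Longrightarrow> p i k \<in> V"
  shows False
proof -
  interpret theta_graph E "{0, 1, 2}" l p u v by fact
  have "support \<subseteq> V" using assms(3) unfolding support_def by blast
  then show False
    using unique connected_on_support not_unique_geodesics_on_three_paths[OF refl assms(2)] by blast
qed

text \<open>By connectedness some edge \<open>(s, x)\<close> leaves \<open>S\<close>. As
  \<open>s\<close> is not a cut vertex, \<open>x\<close> reaches another vertex of \<open>S\<close>
  without passing \<open>s\<close>, so there are walks through the outside between distinct vertices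
  of \<open>S\<close>. Minimal length of such a walk excludes chords and further attachments to
  \<open>S\<close>.\<close>

lemma induced_ear_exists:
  assumes "S \<subset> V" and two: "a \<in> S" "b \<in> S" "a \<noteq> b"
  obtains q n where "induced_ear E S q n"
proof -
  \<comment> \<open>A shortest walk in \<open>A\<close> between distinct vertices of \<open>S\<close> automatically avoids \<open>S\<close> inside.\<close>
  define A where "A = {(x, y) \<in> E. x \<notin> S \<or> y \<notin> S}"
  have A_sym: "(x, y) \<in> A \<Longrightarrow> (y, x) \<in> A" for x y
    using E_sym by (auto simp: A_def)
  obtain c where c: "c \<in> V" "c \<notin> S" using \<open>S \<subset> V\<close> by auto
  have "(a, c) \<in> (E \<inter> V \<times> V)\<^sup>*"
    using connected c two \<open>S \<subset> V\<close> by (auto simp: connected_on_def)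
  then have "\<exists>s x. s \<in> S \<and> x \<notin> S \<and> (s, x) \<in> E"
    using c(2) two(1) by (induction rule: rtrancl_induct) blast+
  then obtain s x where s: "s \<in> S" and x: "x \<notin> S" "(s, x) \<in> E" by blast
  obtain t where t: "t \<in> S" "t \<noteq> s" using two by metis
  have "(x, t) \<in> (E \<inter> (V - {s}) \<times> (V - {s}))\<^sup>*"
  proof -
    have "s \<in> V" "x \<in> V - {s}" "t \<in> V - {s}" using s t x E_verts \<open>S \<subset> V\<close> by blast+
    then show ?thesis using no_cut by (auto simp: connected_on_def)
  qed
  \<comment> \<open>Up to its first vertex in \<open>S\<close> the walk stays in \<open>A\<close>;
    that vertex is not \<open>s\<close>, which has been deleted.\<close>
  then have "x \<in> S \<or> (\<exists>t\<in>S - {s}. (x, t) \<in> A\<^sup>*)"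
  proof (induction rule: converse_rtrancl_induct)
    case base
    then show ?case using t by auto
  next
    case (step y z)
    show ?case
    proof (cases "y \<in> S")
      case False
      then have "(y, z) \<in> A" using step(1) by (auto simp: A_def)
      then show ?thesis
        using step by (cases "z \<in> S") (auto intro: converse_rtrancl_into_rtrancl)
    qed simp
  qed
  moreover have "(s, x) \<in> A" using x by (auto simp: A_def)
  ultimately obtain t' where "t' \<in> S" "t' \<noteq> s" "(s, t') \<in> A\<^sup>*"
    using x by (blast intro: converse_rtrancl_into_rtrancl)
  then have ex: "\<exists>n. \<exists>s\<in>S. \<exists>t\<in>S. s \<noteq> t \<and> (s, t) \<in> A ^^ n"
    using s rtrancl_imp_relpow by metis
  define n where "n = (LEAST n. \<exists>s\<in>S. \<exists>t\<in>S. s \<noteq> t \<and> (s, t) \<in> A ^^ n)"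
  have min: "n \<le> m" if "s \<in> S" "t \<in> S" "s \<noteq> t" "(s, t) \<in> A ^^ m" for s t m
    unfolding n_def by (rule Least_le) (use that in blast)
  obtain s t where st: "s \<in> S" "t \<in> S" "s \<noteq> t" "(s, t) \<in> A ^^ n"
    using LeastI_ex[OF ex] unfolding n_def by blast
  then obtain q where q: "q 0 = s" "q n = t" "\<And>k. k < n \<Longrightarrow> (q k, q (Suc k)) \<in> A"
    by (auto simp: relpow_fun_conv)
  have seg: "(q i, q (i + d)) \<in> A ^^ d" if "i + d \<le> n" for i d
    unfolding relpow_fun_conv using that q(3) by (intro exI[of _ "\<lambda>k. q (i + k)"]) auto
  have pre: "(s, q i) \<in> A ^^ i" if "i \<le> n" for i
    using seg[of 0 i] that q by auto
  have suf: "(q i, t) \<in> A ^^ (n - i)" if "i \<le> n" for i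
    using seg[of i "n - i"] that q by auto
  \<comment> \<open>A walk in \<open>A\<close> of length \<open>m\<close> may replace the segment
    from \<open>q i\<close> to \<open>q k\<close>. With \<open>m = 0\<close> this gives injectivity,
    with \<open>m = 1\<close> the absence of chords.\<close>
  have shortcut: "k \<le> i + m" if "k \<le> n" "i \<le> n" "(q i, q k) \<in> A ^^ m" for i k m
  proof -
    have "(s, t) \<in> A ^^ i O A ^^ m O A ^^ (n - k)"
      using pre[OF that(2)] that(3) suf[OF that(1)] by blast
    then have "(s, t) \<in> A ^^ (i + (m + (n - k)))" by (simp only: relpow_add)
    then have "n \<le> i + (m + (n - k))" using min st by blast
    then show ?thesis using that by linarith
  qed
  have n2: "2 \<le> n"
  proof (rule ccontr)
    assume "\<not> 2 \<le> n"
    then have "n = 0 \<or> n = 1" by auto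
    then show False using st by (auto simp: A_def)
  qed
  \<comment> \<open>As \<open>s \<noteq> t\<close>, a vertex \<open>q k\<close> in \<open>S\<close>
    differs from one of them, and the corresponding part of the walk would be too short.\<close>
  have out: "q k \<notin> S" if "0 < k" "k < n" for k
  proof
    assume "q k \<in> S"
    then show False
      using min[of s "q k" k] min[of "q k" t "n - k"] pre[of k] suf[of k] st that by fastforce
  qed
  have "induced_ear E S q n"
    unfolding induced_ear_def
  proof (intro conjI allI impI)
    show "q 0 \<in> S" "q n \<in> S" "q 0 \<noteq> q n" "2 \<le> n" using q st n2 by auto
    show "inj_on q {..n}"
    proof (rule inj_onI)
      fix i k assume "i \<in> {..n}" "k \<in> {..n}" "q i = q k"
      then show "i = k" using shortcut[of i k 0] shortcut[of k i 0] by auto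
    qed
    show "(q k, q (Suc k)) \<in> E" if "k < n" for k using q(3)[OF that] by (auto simp: A_def)
    show "q k \<notin> S" if "0 < k" "k < n" for k by (rule out[OF that])
    show "k = Suc i \<or> i = 0 \<and> k = n" if "i < k" "k \<le> n" "(q i, q k) \<in> E" for i k
    proof (cases "i = 0 \<and> k = n")
      case False
      then have "q i \<notin> S \<or> q k \<notin> S" using out[of i] out[of k] that by fastforce
      then have "(q i, q k) \<in> A" using that by (auto simp: A_def)
      then show ?thesis using shortcut[of k i 1] that by auto
    qed simp
    show "z = q 0 \<or> z = q n \<or> n = 2" if "0 < k" "k < n" "z \<in> S" "(q k, z) \<in> E" for k z
    proof (rule ccontr)
      assume neq: "\<not> (z = q 0 \<or> z = q n \<or> n = 2)"
      have "(q k, z) \<in> A" using out[OF that(1,2)] that(4) by (auto simp: A_def)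
      \<comment> \<open>Detours via \<open>q k\<close> join \<open>s\<close> to \<open>z\<close> in
        \<open>k + 1\<close> steps and \<open>z\<close> to \<open>t\<close> in
        \<open>n - k + 1\<close> steps. By minimality \<open>k \<ge> n - 1\<close> and
        \<open>k \<le> 1\<close>, which forces \<open>n = 2\<close>.\<close>
      then have "(s, z) \<in> A ^^ Suc k"
        using pre[of k] that by (blast intro: relpow_Suc_I less_imp_le)
      moreover have "(z, t) \<in> A ^^ Suc (n - k)"
        using A_sym[OF \<open>(q k, z) \<in> A\<close>] suf[of k] that by (blast intro: relpow_Suc_I2 less_imp_le)
      ultimately have "n \<le> Suc k" "n \<le> Suc (n - k)"
        using min[of s z "Suc k"] min[of z t "Suc (n - k)"] neq st q that by blast+
      then show False using neq n2 that by auto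
    qed
  qed
  then show thesis by (rule that)
qed

end

section \<open>Cliques and cycles\<close>

text \<open>The cycle has \<open>n + 1\<close> vertices, so it is odd when \<open>n\<close> is even.\<close>

definition induced_cycle :: "'a rel \<Rightarrow> (nat \<Rightarrow> 'a) \<Rightarrow> nat \<Rightarrow> bool" where
  "induced_cycle E c n \<longleftrightarrow> 2 \<le> n \<and> inj_on c {..n} \<and> (\<forall>k<n. (c k, c (Suc k)) \<in> E) \<and> (c 0, c n) \<in> E
     \<and> (\<forall>i k. i < k \<longrightarrow> k \<le> n \<longrightarrow> (c i, c k) \<in> E \<longrightarrow> k = Suc i \<or> i = 0 \<and> k = n)"

lemma induced_cycleD:
  assumes "induced_cycle E c n"
  shows "2 \<le> n" "inj_on c {..n}" "\<And>k. k < n \<Longrightarrow> (c k, c (Suc k)) \<in> E" "(c 0, c n) \<in> E"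
    "\<And>i k. \<lbrakk>i < k; k \<le> n; (c i, c k) \<in> E\<rbrakk> \<Longrightarrow> k = Suc i \<or> i = 0 \<and> k = n"
  using assms by (auto simp: induced_cycle_def)

text \<open>Reversing the numbering allows the ends of an ear to be taken in increasing
  order.\<close>

lemma induced_cycle_rev:
  assumes "sym E" and c: "induced_cycle E c n"
  shows "induced_cycle E (\<lambda>k. c (n - k)) n"
  unfolding induced_cycle_def
proof (intro conjI allI impI)
  note D = induced_cycleD[OF c]
  have E_sym: "(a, b) \<in> E \<Longrightarrow> (b, a) \<in> E" for a b
    using \<open>sym E\<close> by (auto simp: sym_def)
  show "2 \<le> n" by (rule D)
  show "inj_on (\<lambda>k. c (n - k)) {..n}"
    by (rule inj_onI) (use D(2) in \<open>fastforce dest: inj_onD\<close>)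
  show "(c (n - k), c (n - Suc k)) \<in> E" if "k < n" for k
    using D(3)[of "n - Suc k"] that E_sym by (auto simp: Suc_diff_Suc)
  show "(c (n - 0), c (n - n)) \<in> E" using D(4) E_sym by simp
  show "k = Suc i \<or> i = 0 \<and> k = n" if "i < k" "k \<le> n" "(c (n - i), c (n - k)) \<in> E" for i k
    using D(5)[of "n - k" "n - i"] that E_sym by fastforce
qed

context hereditarily_geodetic_block
begin

lemma induced_cycle_verts:
  assumes "induced_cycle E c n" "k \<le> n"
  shows "c k \<in> V"
  using assms(2) induced_cycleD(3)[OF assms(1), of k] induced_cycleD(4)[OF assms(1)] E_verts
  by (cases "k = n") auto

text \<open>The cycle is a union of two paths with the adjacent poles \<open>c 0\<close> and
  \<open>c n\<close>: the edge between them, and the remaining path of odd length \<open>n\<close>.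
  Both lengths are odd, so their parities agree.\<close>

lemma even_hole_False:
  assumes c: "induced_cycle E c n" and "odd n"
  shows False
proof -
  note D = induced_cycleD[OF c]
  define l where "l i = (if i = 0 then n else 1)" for i :: nat
  define p where "p i k = (if i = 0 then c k else if k = 0 then c 0 else c n)" for i k :: nat
  have c_eq: "c a = c b \<longleftrightarrow> a = b" if "a \<le> n" "b \<le> n" for a b
    using inj_on_eq_iff[OF D(2)] that by auto
  have mem: "\<exists>a\<le>n. p i k = c a" if "i \<in> {0, 1}" "k \<le> l i" for i k
    using that by (auto simp: p_def l_def)
  interpret theta_graph E "{0, 1}" l p "c 0" "c n"
  proof
    show "sym E" by (rule sym)
    fix i :: nat assume "i \<in> {0, 1}"
    then show "p i 0 = c 0" "p i (l i) = c n" "0 < l i"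
      using D(1) by (auto simp: p_def l_def)
    show "(p i k, p i (Suc k)) \<in> E" if "k < l i" for k
      using that D(3,4) \<open>i \<in> {0, 1}\<close> by (auto simp: p_def l_def)
  next
    fix i j k m :: nat assume *: "i \<in> {0, 1}" "j \<in> {0, 1}" "k \<le> l i" "m \<le> l j"
    show "i = j \<and> k = m \<or> k = 0 \<and> m = 0 \<or> k = l i \<and> m = l j" if "p i k = p j m"
      using * that D(1) by (auto simp: p_def l_def c_eq le_Suc_eq split: if_splits)
    assume edge: "(p i k, p j m) \<in> E"
    obtain a b where ab: "p i k = c a" "p j m = c b" "a \<le> n" "b \<le> n" using mem * by metis
    have con: "\<exists>i'\<in>{0, 1}. \<exists>k'<l i'. c a = p i' k' \<and> c b = p i' (Suc k')
                        \<or> c a = p i' (Suc k') \<and> c b = p i' k'"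
      if "a < b" "b \<le> n" "(c a, c b) \<in> E" for a b
    proof (cases "b = Suc a")
      case True
      then show ?thesis
        using that by (intro bexI[of _ 0] exI[of _ a]) (auto simp: p_def l_def)
    next
      case False
      then show ?thesis
        using D(5)[OF that] by (intro bexI[of _ 1] exI[of _ 0]) (auto simp: p_def l_def)
    qed
    show "\<exists>i'\<in>{0, 1}. \<exists>k'<l i'. p i k = p i' k' \<and> p j m = p i' (Suc k')
                        \<or> p i k = p i' (Suc k') \<and> p j m = p i' k'"
      using con[of a b] con[of b a] ab edge E_sym E_neq by (metis linorder_neqE_nat)
  qed
  have "support \<subseteq> V"
    unfolding support_def using induced_cycle_verts[OF c] by (auto simp: p_def l_def)
  then show False
    using unique connected_on_support not_unique_geodesics_on_support[of 0 1] \<open>odd n\<close> D(1)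
    by (auto simp: l_def)
qed

text \<open>The vertices \<open>c i\<close> and \<open>c j\<close> split the cycle into two arcs,
  which form an induced theta graph with \<open>q\<close>. The arcs have total length
  \<open>l + 1 \<ge> 3\<close> and \<open>q\<close> has length at least two, so at most one of the
  three paths is a single edge.\<close>

lemma cycle_ear_False:
  assumes c: "induced_cycle E c l" and "i < j" "j \<le> l" and q0: "q 0 = c i" and qn: "q n = c j"
    and n: "2 \<le> n" and q_inj: "inj_on q {..n}" and q_step: "\<And>k. k < n \<Longrightarrow> (q k, q (Suc k)) \<in> E"
    and q_out: "\<And>k. \<lbrakk>0 < k; k < n\<rbrakk> \<Longrightarrow> q k \<notin> c ` {..l}"
    and q_ind: "\<And>a b. \<lbrakk>a < b; b \<le> n; (q a, q b) \<in> E\<rbrakk> \<Longrightarrow> b = Suc a \<or> a = 0 \<and> b = n"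
    and q_c: "\<And>k m. \<lbrakk>0 < k; k < n; m \<le> l; (q k, c m) \<in> E\<rbrakk> \<Longrightarrow> m = i \<or> m = j"
  shows False
proof -
  note D = induced_cycleD[OF c]
  define len where "len = (\<lambda>r::nat. if r = 0 then j - i else if r = 1 then l + 1 + i - j else n)"
  \<comment> \<open>Positions on the arc that avoids the part between \<open>i\<close> and
    \<open>j\<close>: down from \<open>i\<close> to \<open>0\<close>, across the closing edge to
    \<open>l\<close>, and down to \<open>j\<close>.\<close>
  define arc where "arc k = (if k \<le> i then i - k else l + 1 + i - k)" for k
  define p where "p = (\<lambda>(r::nat) k. if r = 0 then c (i + k) else if r = 1 then c (arc k) else q k)"
  have len: "len 0 = j - i" "len (Suc 0) = l + 1 + i - j" "len 2 = n"
    and p: "p 0 k = c (i + k)" "p (Suc 0) k = c (arc k)" "p 2 k = q k" for k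
    by (auto simp: len_def p_def)
  have c_eq: "c a = c b \<longleftrightarrow> a = b" if "a \<le> l" "b \<le> l" for a b
    using inj_on_eq_iff[OF D(2)] that by auto
  have q_eq: "q a = q b \<longleftrightarrow> a = b" if "a \<le> n" "b \<le> n" for a b
    using inj_on_eq_iff[OF q_inj] that by auto
  have q_c_eq: "a = 0 \<and> b = i \<or> a = n \<and> b = j" if "a \<le> n" "b \<le> l" "q a = c b" for a b
  proof -
    have "a = 0 \<or> a = n" using q_out[of a] that by force
    then show ?thesis using that q0 qn c_eq \<open>i < j\<close> \<open>j \<le> l\<close> by auto
  qed
  have arc_le: "arc k \<le> l" if "k \<le> l + 1 + i - j" for k
    using that \<open>i < j\<close> \<open>j \<le> l\<close> by (auto simp: arc_def)
  have arc_inj: "k = m" if "k \<le> l + 1 + i - j" "m \<le> l + 1 + i - j" "arc k = arc m" for k m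
    using that \<open>i < j\<close> \<open>j \<le> l\<close> by (auto simp: arc_def split: if_splits)
  have arc_i: "arc k = i \<longleftrightarrow> k = 0" and arc_j: "arc k = j \<longleftrightarrow> k = l + 1 + i - j"
    if "k \<le> l + 1 + i - j" for k
    using that \<open>i < j\<close> \<open>j \<le> l\<close> by (auto simp: arc_def)
  have arc_arc: "k = 0 \<and> m = 0 \<or> k = j - i \<and> m = l + 1 + i - j"
    if "k \<le> j - i" "m \<le> l + 1 + i - j" "i + k = arc m" for k m
    using that \<open>i < j\<close> \<open>j \<le> l\<close> by (auto simp: arc_def split: if_splits)
  note c_V = induced_cycle_verts[OF c]
  have q_V: "q k \<in> V" if "k \<le> n" for k
    using that q_step[of k] E_verts(1) qn c_V \<open>j \<le> l\<close> by (cases "k = n") auto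
  \<comment> \<open>By symmetry it suffices to treat \<open>r \<le> s\<close>, that is, six pairs of
    paths.\<close>
  have disj: "r = s \<and> k = m \<or> k = 0 \<and> m = 0 \<or> k = len r \<and> m = len s"
    if "r \<le> s" "s \<le> 2" "k \<le> len r" "m \<le> len s" "p r k = p s m" for r s k m
  proof -
    have "r = 0 \<and> s = 0 \<or> r = 0 \<and> s = 1 \<or> r = 0 \<and> s = 2 \<or> r = 1 \<and> s = 1 \<or> r = 1 \<and> s = 2 \<or>
        r = 2 \<and> s = 2"
      using that(1,2) by arith
    then consider "r = 0" "s = 0" | "r = 0" "s = 1" | "r = 0" "s = 2" | "r = 1" "s = 1"
      | "r = 1" "s = 2" | "r = 2" "s = 2" by blast
    then show ?thesis
    proof cases
      case 1
      then show ?thesis using that \<open>j \<le> l\<close> by (auto simp: p len c_eq)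
    next
      case 2
      then have "i + k = arc m"
        using that \<open>i < j\<close> \<open>j \<le> l\<close> arc_le[of m] by (auto simp: p len c_eq)
      then show ?thesis using 2 that arc_arc[of k m] by (auto simp: len)
    next
      case 3
      then have "i + k \<le> l" using that \<open>i < j\<close> \<open>j \<le> l\<close> by (simp add: len)
      then show ?thesis using 3 that q_c_eq[of m "i + k"] by (auto simp: p len)
    next
      case 4
      then show ?thesis using that arc_le arc_inj[of k m] by (auto simp: p len c_eq)
    next
      case 5
      then show ?thesis using that arc_le[of k] q_c_eq[of m "arc k"] arc_i arc_j
        by (auto simp: p len)
    next
      case 6
      then show ?thesis using that by (auto simp: p len q_eq)
    qed
  qed
  \<comment> \<open>This is the conclusion of the locale assumption \<open>induced\<close>. It is
    verified in turn for edges within the cycle, within the ear, and between ear and cycle.\<close>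
  define con where "con a b \<longleftrightarrow> (\<exists>r\<in>{0, 1, 2}. \<exists>k<len r. a = p r k \<and> b = p r (Suc k)
      \<or> a = p r (Suc k) \<and> b = p r k)" for a b
  have con_sym: "con a b \<Longrightarrow> con b a" for a b by (auto simp: con_def)
  have con_I: "con (p r k) (p r (Suc k))" if "r \<in> {0, 1, 2}" "k < len r" for r k
    unfolding con_def using that by blast
  have con_c: "con (c x) (c (Suc x))" if "x < l" for x
  proof -
    consider "x < i" | "i \<le> x" "x < j" | "j \<le> x" by linarith
    then show ?thesis
    proof cases
      case 1
      have "con (p 1 (i - Suc x)) (p 1 (Suc (i - Suc x)))"
        by (rule con_I) (use 1 \<open>j \<le> l\<close> in \<open>auto simp: len\<close>)
      moreover have "arc (i - Suc x) = Suc x" "arc (Suc (i - Suc x)) = x"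
        using 1 by (auto simp: arc_def)
      ultimately show ?thesis using con_sym by (simp add: p)
    next
      case 2
      then show ?thesis using con_I[of 0 "x - i"] by (auto simp: p len Suc_diff_le)
    next
      case 3
      have "con (p 1 (l + i - x)) (p 1 (Suc (l + i - x)))"
        by (rule con_I) (use 3 that in \<open>auto simp: len\<close>)
      moreover have "arc (l + i - x) = Suc x" "arc (Suc (l + i - x)) = x"
        using 3 that by (auto simp: arc_def)
      ultimately show ?thesis using con_sym by (simp add: p)
    qed
  qed
  have con_c0: "con (c 0) (c l)"
  proof -
    have "con (p 1 i) (p 1 (Suc i))"
      by (rule con_I) (use \<open>j \<le> l\<close> in \<open>auto simp: len\<close>)
    then show ?thesis by (simp add: p arc_def)
  qed
  have con_q: "con (q k) (q (Suc k))" if "k < n" for k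
    using con_I[of 2 k] that by (simp add: p len)
  have cc: "con (c a) (c b)" if "a < b" "b \<le> l" "(c a, c b) \<in> E" for a b
    using D(5)[OF that] con_c[of a] con_c0 that by auto
  have cc': "con (c a) (c b)" if "a \<le> l" "b \<le> l" "(c a, c b) \<in> E" for a b
    using cc[of a b] cc[of b a] that E_sym E_neq con_sym by (metis linorder_neqE_nat)
  \<comment> \<open>An edge between the two ends of the ear is an edge of the cycle, so it is one of
    the arcs rather than a chord.\<close>
  have qq: "con (q a) (q b)" if "a < b" "b \<le> n" "(q a, q b) \<in> E" for a b
    using q_ind[OF that] con_q[of a] cc'[of i j] that q0 qn \<open>i < j\<close> \<open>j \<le> l\<close> by auto
  have qq': "con (q a) (q b)" if "a \<le> n" "b \<le> n" "(q a, q b) \<in> E" for a b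
    using qq[of a b] qq[of b a] that E_sym E_neq con_sym by (metis linorder_neqE_nat)
  have qc: "con (q a) (c b)" if "a \<le> n" "b \<le> l" "(q a, c b) \<in> E" for a b
  proof -
    have "a = 0 \<or> a = n \<or> b = i \<or> b = j"
      using q_c[of a b] that by fastforce
    then consider "a = 0" | "a = n" | "b = i" | "b = j" by blast
    then show ?thesis
      using that q0 qn cc'[of i b] cc'[of j b] qq'[of a 0] qq'[of a n] \<open>i < j\<close> \<open>j \<le> l\<close>
      by cases auto
  qed
  have mem: "(\<exists>a\<le>l. p r k = c a) \<or> (\<exists>a\<le>n. p r k = q a)" if "r \<in> {0, 1, 2}" "k \<le> len r" for r k
  proof -
    have "i + k \<le> l" if "k \<le> j - i" using that \<open>i < j\<close> \<open>j \<le> l\<close> by linarith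
    then show ?thesis using that arc_le[of k] by (auto simp: p len)
  qed
  show False
  proof (rule theta_graph_False)
    show "theta_graph E {0, 1, 2} len p (c i) (c j)"
    proof
      show "sym E" by (rule sym)
      fix r :: nat assume r: "r \<in> {0, 1, 2}"
      then show "p r 0 = c i" "0 < len r"
        using \<open>i < j\<close> \<open>j \<le> l\<close> n q0 by (auto simp: p len arc_def)
      show "p r (len r) = c j"
        using r \<open>i < j\<close> \<open>j \<le> l\<close> qn arc_j[of "l + 1 + i - j"] by (auto simp: p len)
      show "(p r k, p r (Suc k)) \<in> E" if "k < len r" for k
      proof -
        have "(p 1 k, p 1 (Suc k)) \<in> E" if "k < len 1"
        proof -
          consider "k < i" | "k = i" | "i < k" by linarith
          then show ?thesis
          proof cases
            case 1
            then have "(c (i - Suc k), c (Suc (i - Suc k))) \<in> E"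
              using \<open>i < j\<close> \<open>j \<le> l\<close> by (intro D(3)) auto
            then show ?thesis using 1 E_sym by (simp add: p arc_def Suc_diff_Suc)
          next
            case 2
            then show ?thesis using D(4) by (simp add: p arc_def)
          next
            case 3
            then have "(c (l + i - k), c (Suc (l + i - k))) \<in> E"
              using that \<open>i < j\<close> \<open>j \<le> l\<close> by (intro D(3)) (auto simp: len)
            moreover have "arc k = Suc (l + i - k)" "arc (Suc k) = l + i - k"
              using 3 that \<open>i < j\<close> \<open>j \<le> l\<close> by (auto simp: len arc_def)
            ultimately show ?thesis using E_sym by (simp add: p)
          qed
        qed
        then show ?thesis using that r D(3) q_step \<open>j \<le> l\<close> by (auto simp: p len)
      qed
    next
      fix r s k m :: nat
      assume *: "r \<in> {0, 1, 2}" "s \<in> {0, 1, 2}" "k \<le> len r" "m \<le> len s"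
      then have le: "r \<le> 2" "s \<le> 2" by auto
      show "r = s \<and> k = m \<or> k = 0 \<and> m = 0 \<or> k = len r \<and> m = len s" if "p r k = p s m"
      proof (cases "r \<le> s")
        case True
        then show ?thesis using disj[OF _ le(2) *(3,4) that] by blast
      next
        case False
        then show ?thesis using disj[OF _ le(1) *(4,3) that[symmetric]] by auto
      qed
      assume "(p r k, p s m) \<in> E"
      then have "con (p r k) (p s m)"
        using mem[OF *(1,3)] mem[OF *(2,4)]
        by (elim disjE exE conjE) (auto intro: cc' qq' qc con_sym[OF qc] E_sym)
      then show "\<exists>i'\<in>{0, 1, 2}. \<exists>k'<len i'. p r k = p i' k' \<and> p s m = p i' (Suc k')
                        \<or> p r k = p i' (Suc k') \<and> p s m = p i' k'"
        by (simp only: con_def)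
    qed
    show "2 \<le> len r \<or> 2 \<le> len s" if "r \<in> {0, 1, 2}" "s \<in> {0, 1, 2}" "r \<noteq> s" for r s
      using that n D(1) \<open>i < j\<close> \<open>j \<le> l\<close> by (auto simp: len)
    show "p r k \<in> V" if "r \<in> {0, 1, 2}" "k \<le> len r" for r k
      using mem[OF that] c_V q_V by auto
  qed
qed

section \<open>Triangles, cliques and shortest cycles\<close>

lemma triangle_imp_complete:
  assumes abc: "(a, b) \<in> E" "(b, c) \<in> E" "(a, c) \<in> E" and "x \<in> V" "y \<in> V" "x \<noteq> y"
  shows "(x, y) \<in> E"
proof -
  define cliques where "cliques = {K. K \<subseteq> V \<and> (\<forall>x\<in>K. \<forall>y\<in>K. x \<noteq> y \<longrightarrow> (x, y) \<in> E)}"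
  have "finite cliques" using finite_V by (simp add: cliques_def)
  moreover have "{a, b, c} \<in> cliques"
    using abc E_verts E_sym by (auto simp: cliques_def)
  ultimately obtain K where K: "K \<in> cliques" "{a, b, c} \<subseteq> K"
    and max: "\<And>K'. K' \<in> cliques \<Longrightarrow> K \<subseteq> K' \<Longrightarrow> K = K'"
    using finite_has_maximal2 by metis
  have K_E: "(x, y) \<in> E" if "x \<in> K" "y \<in> K" "x \<noteq> y" for x y
    using K(1) that by (auto simp: cliques_def)
  have "K \<subseteq> V" using K(1) by (simp add: cliques_def)
  have "K = V"
  proof (rule ccontr)
    assume "K \<noteq> V"
    then have "K \<subset> V" using \<open>K \<subseteq> V\<close> by blast
    have "a \<in> K" "b \<in> K" "a \<noteq> b" using K(2) E_neq abc by auto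
    obtain q n where ear: "induced_ear E K q n"
      using induced_ear_exists[OF \<open>K \<subset> V\<close> \<open>a \<in> K\<close> \<open>b \<in> K\<close> \<open>a \<noteq> b\<close>] .
    note ends = induced_earD(1-3)[OF ear] and q = induced_earD(5-9)[OF ear]
    \<comment> \<open>The third vertex must have no neighbour inside the ear. If
      \<open>n = 2\<close>, maximality of \<open>K\<close> gives a non-neighbour of
      \<open>q 1\<close>, and it is not an end because both ends are neighbours. Otherwise inner
      vertices of the ear see only its ends in \<open>K\<close>, and any third vertex of the
      triangle will do.\<close>
    have "\<exists>r\<in>K. r \<noteq> q 0 \<and> r \<noteq> q n \<and> (\<forall>k. 0 < k \<longrightarrow> k < n \<longrightarrow> (q k, r) \<notin> E)"
    proof (cases "n = 2")
      case True
      have "q 1 \<in> V - K" using q(2)[of 1] q(3)[of 1] E_verts(1) True by simp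
      then have "insert (q 1) K \<notin> cliques" using max by blast
      then have "\<exists>r\<in>K. (q 1, r) \<notin> E"
        using \<open>q 1 \<in> V - K\<close> K(1) E_sym by (auto simp: cliques_def)
      then obtain r where "r \<in> K" "(q 1, r) \<notin> E" by blast
      moreover have "(q 1, q 0) \<in> E" "(q 1, q 2) \<in> E"
        using q(2)[of 0] q(2)[of 1] True E_sym by (auto simp: numeral_2_eq_2)
      moreover have "k = 1" if "0 < k" "k < n" for k using that True by simp
      ultimately show ?thesis using True by metis
    next
      case False
      have "a \<noteq> b" "b \<noteq> c" "a \<noteq> c" using E_neq abc by auto
      then have "\<exists>r\<in>{a, b, c}. r \<noteq> q 0 \<and> r \<noteq> q n" by (simp, metis)
      then show ?thesis using q(5) False K(2) by blast
    qed
    then obtain r where r: "r \<in> K" "r \<noteq> q 0" "r \<noteq> q n"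
      and r_adj: "\<And>k. \<lbrakk>0 < k; k < n\<rbrakk> \<Longrightarrow> (q k, r) \<notin> E" by blast
    \<comment> \<open>The triangle on the ends and \<open>r\<close> is the cycle for
      \<open>cycle_ear_False\<close>. Its arcs are the edge between the ends and the path through
      \<open>r\<close>.\<close>
    define d where "d k = (if k = 0 then q 0 else if k = 1 then r else q n)" for k :: nat
    have set_d: "d ` {..2} = {q 0, r, q n}"
      by (auto simp: d_def image_iff Bex_def)
    have d: "d 0 = q 0" "d (Suc 0) = r" "d 2 = q n" by (auto simp: d_def)
    have le2: "k \<le> 2 \<longleftrightarrow> k = 0 \<or> k = 1 \<or> k = 2" and lt2: "k < 2 \<longleftrightarrow> k = 0 \<or> k = 1" for k :: nat
      by auto
    have "induced_cycle E d 2"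
      unfolding induced_cycle_def
    proof (intro conjI allI impI)
      show "inj_on d {..2}" using r ends by (auto simp: inj_on_def d_def le2)
      show "(d k, d (Suc k)) \<in> E" if "k < 2" for k
        using that K_E r ends by (auto simp: lt2 d_def)
      show "(d 0, d 2) \<in> E" using K_E ends by (simp add: d_def)
      show "k = Suc i \<or> i = 0 \<and> k = 2" if "i < k" "k \<le> 2" for i k
        using that by auto
    qed simp
    then show False
    proof (rule cycle_ear_False[of d 2 0 2 q n])
      show "q k \<notin> d ` {..2}" if "0 < k" "k < n" for k
        using q(3)[OF that] set_d r ends by auto
      show "m = 0 \<or> m = 2" if "0 < k" "k < n" "m \<le> 2" "(q k, d m) \<in> E" for k m
        using r_adj[OF that(1,2)] that by (auto simp: le2 d)
    qed (use d q induced_earD(4)[OF ear] in auto)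
  qed
  then show ?thesis using K_E assms by blast
qed

text \<open>An ear of the set \<open>{s, t}\<close> must join \<open>s\<close> and \<open>t\<close>,
  so the edge between them closes it to a cycle.\<close>

lemma exists_cycle:
  assumes "(s, t) \<in> E" "V \<noteq> {s, t}"
  shows "\<exists>c n. 2 \<le> n \<and> inj_on c {..n} \<and> (\<forall>k<n. (c k, c (Suc k)) \<in> E) \<and> (c 0, c n) \<in> E"
proof -
  have "{s, t} \<subset> V" "s \<noteq> t" using assms E_verts E_neq by auto
  obtain q n where ear: "induced_ear E {s, t} q n"
    using induced_ear_exists[OF \<open>{s, t} \<subset> V\<close> insertI1 insertI2[OF singletonI] \<open>s \<noteq> t\<close>] .
  have "(q 0, q n) \<in> E" using induced_earD(1-3)[OF ear] assms E_sym by auto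
  then show ?thesis using induced_earD(4-6)[OF ear] by blast
qed

lemma complete_or_odd_cycle:
  "(\<forall>x\<in>V. \<forall>y\<in>V. x \<noteq> y \<longrightarrow> (x, y) \<in> E) \<or> (\<exists>c n. even n \<and> induced_cycle E c n \<and> c ` {..n} = V)"
proof (rule disjCI)
  assume no_odd: "\<nexists>c n. even n \<and> induced_cycle E c n \<and> c ` {..n} = V"
  show "\<forall>x\<in>V. \<forall>y\<in>V. x \<noteq> y \<longrightarrow> (x, y) \<in> E"
  proof (rule ccontr)
    assume "\<not> ?thesis"
    then obtain a b where ab: "a \<in> V" "b \<in> V" "a \<noteq> b" "(a, b) \<notin> E" by blast
    have no_triangle: False if "(x, y) \<in> E" "(y, z) \<in> E" "(x, z) \<in> E" for x y z
      using triangle_imp_complete[OF that ab(1-3)] ab(4) by blast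
    have "(a, b) \<in> (E \<inter> V \<times> V)\<^sup>*" using connected ab by (auto simp: connected_on_def)
    then obtain s where "(a, s) \<in> E" using \<open>a \<noteq> b\<close> by (auto elim: converse_rtranclE)
    \<comment> \<open>The vertex \<open>b\<close> is a third one: it is not adjacent to
      \<open>a\<close>, whereas \<open>s\<close> is.\<close>
    moreover have "V \<noteq> {a, s}" using calculation ab by auto
    ultimately have ex: "\<exists>n c. 2 \<le> n \<and> inj_on c {..n} \<and> (\<forall>k<n. (c k, c (Suc k)) \<in> E) \<and> (c 0, c n) \<in> E"
      using exists_cycle by metis
    \<comment> \<open>With \<open>c\<close> a shortest cycle, every vertex outside has at most one neighbour on it.\<close>
    define n where "n = (LEAST n. \<exists>c. 2 \<le> n \<and> inj_on c {..n} \<and>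
      (\<forall>k<n. (c k, c (Suc k)) \<in> E) \<and> (c 0, c n) \<in> E)"
    have girth: "n \<le> m"
      if "2 \<le> m" "inj_on c {..m}" "\<And>k. k < m \<Longrightarrow> (c k, c (Suc k)) \<in> E" "(c 0, c m) \<in> E" for c m
      unfolding n_def by (rule Least_le) (use that in blast)
    obtain c where c: "2 \<le> n" "inj_on c {..n}" "\<And>k. k < n \<Longrightarrow> (c k, c (Suc k)) \<in> E" "(c 0, c n) \<in> E"
      using LeastI_ex[OF ex] unfolding n_def by blast
    have c_eq: "c i = c k \<longleftrightarrow> i = k" if "i \<le> n" "k \<le> n" for i k
      using inj_on_eq_iff[OF c(2)] that by auto
    have ind: "induced_cycle E c n"
      unfolding induced_cycle_def
    proof (intro conjI allI impI)
      show "k = Suc i \<or> i = 0 \<and> k = n" if "i < k" "k \<le> n" "(c i, c k) \<in> E" for i k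
      proof (rule disjCI, rule ccontr)
        assume "\<not> (i = 0 \<and> k = n)" "k \<noteq> Suc i"
        \<comment> \<open>A chord closes the segment from \<open>c i\<close> to \<open>c k\<close>
          to a cycle, of index \<open>k - i\<close>.\<close>
        then have "n \<le> k - i"
          using that c(3) by (intro girth[of _ "\<lambda>m. c (i + m)"]) (auto simp: inj_on_def c_eq)
        then show False using that \<open>\<not> (i = 0 \<and> k = n)\<close> by linarith
      qed
    qed (use c in auto)
    then have "even n" using even_hole_False by blast
    have "n \<noteq> 2"
      using no_triangle[of "c 0" "c 1" "c 2"] c(3)[of 0] c(3)[of 1] c(4) by (auto simp: numeral_2_eq_2)
    then have n4: "4 \<le> n" using \<open>even n\<close> c(1) by presburger
    have no_square: False
      if "(x, y) \<in> E" "(y, z) \<in> E" "(z, w) \<in> E" "(x, w) \<in> E" "x \<noteq> z" "y \<noteq> w" for x y z w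
    proof -
      define d where "d k = (if k = 0 then x else if k = 1 then y else if k = 2 then z else w)"
        for k :: nat
      have le3: "k \<le> 3 \<longleftrightarrow> k = 0 \<or> k = 1 \<or> k = 2 \<or> k = 3"
        and lt3: "k < 3 \<longleftrightarrow> k = 0 \<or> k = 1 \<or> k = 2" for k :: nat
        by auto
      have neq: "x \<noteq> y" "y \<noteq> z" "z \<noteq> w" "x \<noteq> w" using that E_neq by auto
      have "n \<le> 3"
      proof (rule girth[of 3 d])
        show "inj_on d {..3}" using that(5,6) neq by (auto simp: inj_on_def d_def le3)
      qed (use that in \<open>auto simp: lt3 d_def\<close>)
      then show False using n4 by simp
    qed
    have no_vertex: False
      if x: "x \<notin> c ` {..n}" and ik: "i < k" "k \<le> n" "(x, c i) \<in> E" "(x, c k) \<in> E" for x i k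
    proof -
      \<comment> \<open>The vertex \<open>x\<close> closes the segment from \<open>c i\<close> to
        \<open>c k\<close> to a cycle. Minimality leaves only pairs at distance at most two the
        other way round the cycle, and there \<open>x\<close> completes a triangle or a
        square.\<close>
      have "n \<le> Suc (k - i)"
      proof (rule girth[of _ "\<lambda>m. if m = 0 then x else c (i + m - 1)"])
        show "inj_on (\<lambda>m. if m = 0 then x else c (i + m - 1)) {..Suc (k - i)}"
          using x ik by (auto simp: inj_on_def c_eq image_iff)
        show "(if m = 0 then x else c (i + m - 1), if Suc m = 0 then x else c (i + Suc m - 1)) \<in> E"
          if "m < Suc (k - i)" for m
          using that ik c(3)[of "i + m - 1"] by auto
      qed (use ik in auto)
      then consider "i = 0" "k = n" | "i = 0" "k = n - 1" | "i = 1" "k = n" using ik by linarith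
      then show False
      proof cases
        case 1
        then show ?thesis using no_triangle[of x "c 0" "c n"] ik c(4) by auto
      next
        case 2
        have "(c (n - 1), c n) \<in> E" using c(3)[of "n - 1"] n4 by simp
        moreover have "x \<noteq> c n" "c (n - 1) \<noteq> c 0" using x n4 by (auto simp: c_eq)
        ultimately show ?thesis using no_square[of x "c (n - 1)" "c n" "c 0"] 2 ik c(4) E_sym by auto
      next
        case 3
        moreover have "(c 0, c 1) \<in> E" using c(3)[of 0] n4 by simp
        moreover have "x \<noteq> c 0" "c 1 \<noteq> c n" using x n4 by (auto simp: c_eq)
        ultimately show ?thesis using no_square[of x "c 1" "c 0" "c n"] ik c(4) E_sym by auto
      qed
    qed
    have "c ` {..n} \<subset> V"
      using induced_cycle_verts[OF ind] no_odd ind \<open>even n\<close> by auto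
    have "c 0 \<in> c ` {..n}" "c n \<in> c ` {..n}" "c 0 \<noteq> c n"
      using n4 by (auto simp: c_eq)
    obtain q m where ear: "induced_ear E (c ` {..n}) q m"
      using induced_ear_exists[OF \<open>c ` {..n} \<subset> V\<close> \<open>c 0 \<in> c ` {..n}\<close> \<open>c n \<in> c ` {..n}\<close> \<open>c 0 \<noteq> c n\<close>] .
    note ends = induced_earD(1-3)[OF ear] and m2 = induced_earD(4)[OF ear]
      and q = induced_earD(5-9)[OF ear]
    obtain i j where "q 0 = c i" "i \<le> n" "q m = c j" "j \<le> n" using ends(1,2) by auto
    then have ij: "q 0 = c i" "i \<le> n" "q m = c j" "j \<le> n" "i \<noteq> j" using ends(3) by auto
    have "m \<noteq> 2"
    proof
      assume "m = 2"
      then have "(q 1, c i) \<in> E" "(q 1, c j) \<in> E" "q 1 \<notin> c ` {..n}"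
        using q(2)[of 0] q(2)[of 1] q(3)[of 1] ij E_sym by (auto simp: numeral_2_eq_2)
      then show False
        using no_vertex[of "q 1" i j] no_vertex[of "q 1" j i] ij by linarith
    qed
    have q_c: "k' = i \<or> k' = j" if "0 < k" "k < m" "k' \<le> n" "(q k, c k') \<in> E" for k k'
      using q(5)[OF that(1,2) _ that(4)] that(3) ij \<open>m \<noteq> 2\<close> by (auto simp: c_eq)
    show False
    proof (cases "i < j")
      case True
      then show False
        by (rule cycle_ear_False[OF ind, of i j q m]) (use ij q q_c m2 in auto)
    next
      case False
      \<comment> \<open>With \<open>j < i\<close> the reversed cycle has the ends in the right
        order, at positions \<open>n - i\<close> and \<open>n - j\<close>.\<close>
      show False
      proof (rule cycle_ear_False[OF induced_cycle_rev[OF sym ind], of "n - i" "n - j" q m])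
        show "n - i < n - j" using False ij by linarith
        have "(\<lambda>k. c (n - k)) ` {..n} \<subseteq> c ` {..n}" by auto
        then show "q k \<notin> (\<lambda>k. c (n - k)) ` {..n}" if "0 < k" "k < m" for k
          using q(3)[OF that] by blast
        show "k' = n - i \<or> k' = n - j" if "0 < k" "k < m" "k' \<le> n" "(q k, c (n - k')) \<in> E" for k k'
          using q_c[OF that(1,2) _ that(4)] that(3) by auto
      qed (use ij q m2 in auto)
    qed
  qed
qed

end

section \<open>Blocks of digraphs\<close>

lemma connected_on_mono: "connected_on E S \<Longrightarrow> E \<subseteq> F \<Longrightarrow> connected_on F S"
  unfolding connected_on_def by (meson Int_mono rtrancl_mono subset_iff subset_refl)

lemma arcs_ends_induce: "arcs_ends (G \<restriction> S) = arcs_ends G \<inter> S \<times> S"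
  by (auto simp: arcs_ends_conv)

lemma arcs_ends_del_vert:
  "arcs_ends (pre_digraph.del_vert G c) = arcs_ends G \<inter> (- {c}) \<times> (- {c})"
  by (auto simp: arcs_ends_conv pre_digraph.del_vert_def)

lemma (in graph) graph_induce:
  assumes "S \<subseteq> verts G"
  shows "graph (G \<restriction> S)"
proof -
  have "induced_subgraph (G \<restriction> S) G" using assms by (rule induced_induce)
  then show ?thesis
    using digraphI_induced induced_graph_imp_symmetric sym_arcs digraph.graphI by blast
qed

lemma (in wf_digraph) arcs_ends_subset: "arcs_ends G \<subseteq> verts G \<times> verts G"
  by (auto simp: arcs_ends_conv)

lemma (in graph) connected_iff_connected_on:
  "Digraph_Component.connected G \<longleftrightarrow> verts G \<noteq> {} \<and> connected_on (arcs_ends G) (verts G)"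
proof -
  have "symcl (arcs_ends G) = arcs_ends G"
    using graph_symmetric by (auto simp: symcl_def)
  moreover have "arcs_ends G \<inter> verts G \<times> verts G = arcs_ends G"
    using arcs_ends_subset by auto
  moreover have "(u, v) \<in> rtrancl_on (verts G) (arcs_ends G) \<longleftrightarrow> (u, v) \<in> (arcs_ends G)\<^sup>*"
    if "u \<in> verts G" for u v
    using reachable_conv'[OF that] by (simp add: reachable_def)
  ultimately show ?thesis by (simp add: connected_conv connected_on_def)
qed

lemma (in wf_digraph) no_cut_vertex_iff:
  assumes "connected_on (arcs_ends G) (verts G)"
  shows "(\<nexists>c. cut_vertex G c) \<longleftrightarrow> (\<forall>c\<in>verts G. connected_on (arcs_ends G) (verts G - {c}))"
proof -
  have "a \<rightarrow>\<^sup>*\<^bsub>pre_digraph.del_vert G c\<^esub> b \<longleftrightarrow>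
      (a, b) \<in> (arcs_ends G \<inter> (verts G - {c}) \<times> (verts G - {c}))\<^sup>*"
    if "a \<in> verts G - {c}" "b \<in> verts G - {c}" for a b c
  proof -
    have "arcs_ends (del_vert c) = arcs_ends G \<inter> (verts G - {c}) \<times> (verts G - {c})"
      using arcs_ends_subset by (auto simp: arcs_ends_del_vert)
    moreover have "a \<in> verts (del_vert c)" using that by (simp add: verts_del_vert)
    ultimately show ?thesis
      using wf_digraph.reachable_conv'[OF wf_digraph_del_vert] by metis
  qed
  moreover have "a \<rightarrow>\<^sup>*\<^bsub>G\<^esub> b" if "a \<in> verts G" "b \<in> verts G" for a b
  proof -
    have "arcs_ends G \<inter> verts G \<times> verts G = arcs_ends G"
      using arcs_ends_subset by auto
    then show ?thesis using assms that by (auto simp: connected_on_def reachable_conv)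
  qed
  ultimately show ?thesis unfolding cut_vertex_def connected_on_def by (metis DiffD1)
qed

text \<open>A bridge from vertex sequences to arc lists. The list of vertices serves to show
  distinctness, the list of ends to find the length and the edges traversed.\<close>

lemma (in wf_digraph) awalk_of_vertex_walk:
  assumes "x 0 \<in> verts G" and "\<And>k. k < n \<Longrightarrow> (x k, x (Suc k)) \<in> arcs_ends G"
  obtains p where "awalk (x 0) p (x n)" "awalk_verts (x 0) p = map x [0..<Suc n]"
    "map (arc_to_ends G) p = map (\<lambda>k. (x k, x (Suc k))) [0..<n]"
proof -
  have "\<exists>p. awalk (x 0) p (x n) \<and> awalk_verts (x 0) p = map x [0..<Suc n] \<and>
      map (arc_to_ends G) p = map (\<lambda>k. (x k, x (Suc k))) [0..<n]"
    using assms(2)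
  proof (induction n)
    case 0
    then show ?case using assms(1) by (auto intro!: exI[of _ "[]"] simp: awalk_Nil_iff)
  next
    case (Suc n)
    then obtain p where p: "awalk (x 0) p (x n)" "awalk_verts (x 0) p = map x [0..<Suc n]"
      "map (arc_to_ends G) p = map (\<lambda>k. (x k, x (Suc k))) [0..<n]" by auto
    obtain e where e: "e \<in> arcs G" "tail G e = x n" "head G e = x (Suc n)"
      using Suc.prems[of n] by auto
    have "awalk (x n) [e] (x (Suc n))" using arc_implies_awalk[OF e(1)] e by simp
    then have w: "awalk (x 0) (p @ [e]) (x (Suc n))" using p(1) by (rule awalk_appendI[rotated])
    moreover have "awalk_verts (x 0) (p @ [e]) = map x [0..<Suc (Suc n)]"
      using awalk_verts_append[OF w] p(2) e by simp
    moreover have "map (arc_to_ends G) (p @ [e]) = map (\<lambda>k. (x k, x (Suc k))) [0..<Suc n]"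
      using p(3) e by (simp add: arc_to_ends_def)
    ultimately show ?case by blast
  qed
  then show thesis using that by blast
qed

text \<open>The increase of \<open>f\<close> between two vertices is a lower bound for the length of
  every walk between them. Both given sequences attain it, so they are geodesics with the same ends
  and come from the same arc list.\<close>

lemma (in wf_digraph) unique_geodesics_on_if_geodetic:
  assumes "geodetic G"
  shows "unique_geodesics_on (arcs_ends G) (verts G)"
  unfolding unique_geodesics_on_def
proof (intro allI impI)
  fix f :: "'a \<Rightarrow> nat" and n k :: nat and x y :: "nat \<Rightarrow> 'a"
  assume lip: "\<forall>a\<in>verts G. \<forall>b\<in>verts G. (a, b) \<in> arcs_ends G \<longrightarrow> f b \<le> Suc (f a)"
    and V: "\<forall>k\<le>n. x k \<in> verts G \<and> y k \<in> verts G"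
    and steps: "\<forall>k<n. (x k, x (Suc k)) \<in> arcs_ends G \<and> (y k, y (Suc k)) \<in> arcs_ends G"
    and ends: "x 0 = y 0" "x n = y n" and f: "f (x n) = f (x 0) + n" and "k \<le> n"
  have lower: "f v \<le> f u + length p" if "awalk u p v" for u p v
    using that
  proof (induction p arbitrary: u)
    case Nil
    then show ?case by (simp add: awalk_Nil_iff)
  next
    case (Cons e p)
    then have "f v \<le> f (head G e) + length p" and e: "e \<in> arcs G" "u = tail G e"
      by (auto simp: awalk_Cons_iff)
    moreover have "f (head G e) \<le> Suc (f u)"
      using lip e in_arcs_imp_in_arcs_ends[OF e(1)] by simp
    ultimately show ?case by simp
  qed
  have geo: "\<exists>p. geodesic G (z 0) p (z n) \<and> awalk_verts (z 0) p = map z [0..<Suc n]"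
    if zV: "\<And>k. k \<le> n \<Longrightarrow> z k \<in> verts G" and z: "\<And>k. k < n \<Longrightarrow> (z k, z (Suc k)) \<in> arcs_ends G"
      and fz: "f (z n) = f (z 0) + n" for z
  proof -
    obtain p where p: "awalk (z 0) p (z n)" "awalk_verts (z 0) p = map z [0..<Suc n]"
        "map (arc_to_ends G) p = map (\<lambda>k. (z k, z (Suc k))) [0..<n]"
      by (rule awalk_of_vertex_walk[of z n]) (use zV z in auto)
    have len: "length p = n" using arg_cong[OF p(3), of length] by simp
    have zstep: "f (z (i + d)) \<le> f (z i) + d" if "i + d \<le> n" for i d
      using that
    proof (induction d)
      case (Suc d)
      then have "f (z (i + d)) \<le> f (z i) + d" by simp
      moreover have "f (z (Suc (i + d))) \<le> Suc (f (z (i + d)))"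
        using lip zV z Suc.prems by auto
      ultimately show ?case by simp
    qed simp
    \<comment> \<open>A total growth of \<open>n\<close> in \<open>n\<close> steps leaves no slack,
      so \<open>f\<close> grows by exactly one in each step; hence no vertex repeats and the walk is
      a path.\<close>
    have "f (z k) = f (z 0) + k" if "k \<le> n" for k
      using zstep[of 0 k] zstep[of k "n - k"] fz that by simp
    then have "inj_on z {0..<Suc n}"
      by (intro inj_onI) (metis add_left_cancel atLeastLessThan_iff less_Suc_eq_le)
    then have "apath (z 0) p (z n)" using p by (simp add: apath_def distinct_map del: upt_Suc)
    moreover have "length p \<le> length q" if "apath (z 0) q (z n)" for q
      using lower[OF awalkI_apath[OF that]] fz len by simp
    ultimately show ?thesis using p(2) by (auto simp: geodesic_def)
  qed
  obtain p where p: "geodesic G (x 0) p (x n)" "awalk_verts (x 0) p = map x [0..<Suc n]"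
    using geo[of x] V steps f by auto
  obtain q where q: "geodesic G (y 0) q (y n)" "awalk_verts (y 0) q = map y [0..<Suc n]"
    using geo[of y] V steps f ends by auto
  have "p = q" using assms p(1) q(1) ends V unfolding geodetic_def by (metis le0 order_refl)
  then have "map x [0..<Suc n] = map y [0..<Suc n]" using p(2) q(2) ends by simp
  then show "x k = y k" using \<open>k \<le> n\<close> by (simp del: upt_Suc)
qed

section \<open>Induced subgraphs, blocks and the final translation\<close>

lemma unique_geodesics_on_restrict:
  "unique_geodesics_on (E \<inter> S \<times> S) S \<Longrightarrow> unique_geodesics_on E S"
  unfolding unique_geodesics_on_def by (simp add: less_imp_le Suc_leI)

text \<open>The empty set satisfies \<open>connected_on\<close>, but the empty digraph is not
  connected, so geodeticity of connected induced subgraphs says nothing about it.\<close>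

lemma unique_geodesics_on_empty: "unique_geodesics_on E {}"
  unfolding unique_geodesics_on_def
proof (intro allI impI)
  fix x y :: "nat \<Rightarrow> 'a" and k n :: nat
  assume "\<forall>k\<le>n. x k \<in> {} \<and> y k \<in> {}"
  then show "x k = y k" by auto
qed

lemma connected_on_restrict: "connected_on (E \<inter> S \<times> S) S \<longleftrightarrow> connected_on E S"
  by (simp add: connected_on_def Int_assoc)

lemma induced_subgraph_trans:
  assumes "induced_subgraph F H" "induced_subgraph H G"
  shows "induced_subgraph F G"
proof (rule induced_subgraphI)
  show "subgraph F G"
    using assms by (meson induced_imp_subgraph subgraph_trans)
  have "tail H = tail G" "head H = head G" "verts F \<subseteq> verts H"
    using assms by (simp_all add: induced_subgraph_def subgraph_def compatible_def)
  moreover have "arcs F = {e \<in> arcs H. tail H e \<in> verts F \<and> head H e \<in> verts F}"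
      "arcs H = {e \<in> arcs G. tail G e \<in> verts H \<and> head G e \<in> verts H}"
    using assms by (simp_all add: induced_subgraph_def)
  ultimately show "arcs F = {e \<in> arcs G. tail G e \<in> verts F \<and> head G e \<in> verts F}"
    by auto
qed

text \<open>Adding all arcs of \<open>G\<close> between vertices of \<open>B\<close> preserves
  connectedness and the absence of cut vertices, so by maximality \<open>B\<close> already has
  them.\<close>

lemma block_imp_induced:
  assumes "graph G" "block B G"
  shows "graph B" "Digraph_Component.connected B" "\<nexists>c. cut_vertex B c" "induced_subgraph B G"
proof -
  interpret G: graph G by fact
  have max: "subgraph B G" "\<And>H. \<lbrakk>H \<noteq> B; subgraph B H; subgraph H G; graph H;
      Digraph_Component.connected H; \<nexists>c. cut_vertex H c\<rbrakk> \<Longrightarrow> False"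
    and B: "graph B" "Digraph_Component.connected B" "\<nexists>c. cut_vertex B c"
    using \<open>block B G\<close> unfolding block_def pre_digraph.max_subgraph_def by blast+
  interpret B: graph B by fact
  define H where "H = G \<restriction> verts B"
  have "verts B \<subseteq> verts G" using max(1) by auto
  then interpret H: graph H unfolding H_def by (rule G.graph_induce)
  have "subgraph B H" unfolding H_def by (rule subgraph_induce_subgraphI2[OF max(1)])
  then have sub: "arcs_ends B \<subseteq> arcs_ends H" by (rule arcs_ends_mono)
  have verts: "verts H = verts B" by (simp add: H_def)
  have B_conn: "verts B \<noteq> {}" "connected_on (arcs_ends B) (verts B)"
    using B(2) B.connected_iff_connected_on by auto
  then have H_conn: "connected_on (arcs_ends H) (verts H)"
    using connected_on_mono sub verts by metis
  have "H = B"
  proof (rule ccontr)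
    assume "H \<noteq> B"
    moreover have "subgraph H G" unfolding H_def
      using \<open>verts B \<subseteq> verts G\<close> G.induced_induce by blast
    moreover have "Digraph_Component.connected H"
      using H_conn B_conn verts H.connected_iff_connected_on by simp
    moreover have "\<nexists>c. cut_vertex H c"
      using B(3) B.no_cut_vertex_iff[OF B_conn(2)] H.no_cut_vertex_iff[OF H_conn]
        connected_on_mono[OF _ sub] verts by simp
    ultimately show False using max(2) \<open>subgraph B H\<close> H.graph_axioms by blast
  qed
  then show "induced_subgraph B G"
    using G.induced_induce[OF \<open>verts B \<subseteq> verts G\<close>] by (simp add: H_def)
  show "graph B" "Digraph_Component.connected B" "\<nexists>c. cut_vertex B c" by (fact B)+
qed

lemma induced_cycle_imp_cycle_digraph:
  assumes "graph G" and c: "induced_cycle (arcs_ends G) c n" and V: "c ` {..n} = verts G"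
  shows "cycle_digraph (Suc n) G"
proof -
  interpret graph G by fact
  note D = induced_cycleD[OF c]
  \<comment> \<open>The sequence is prolonged by one vertex, \<open>x (Suc n) = c 0\<close>, to
    close the walk.\<close>
  define x where "x k = (if k \<le> n then c k else c 0)" for k
  have x0: "x 0 \<in> verts G" using V by (auto simp: x_def)
  have x_step: "(x k, x (Suc k)) \<in> arcs_ends G" if "k < Suc n" for k
    using that D(3,4) graph_symmetric by (auto simp: x_def less_Suc_eq)
  obtain p where p: "awalk (x 0) p (x (Suc n))" "awalk_verts (x 0) p = map x [0..<Suc (Suc n)]"
      "map (arc_to_ends G) p = map (\<lambda>k. (x k, x (Suc k))) [0..<Suc n]"
    by (rule awalk_of_vertex_walk[of x "Suc n"]) (use x0 x_step in auto)
  have len: "length p = Suc n" using arg_cong[OF p(3), of length] by simp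
  have c_eq: "c i = c k \<longleftrightarrow> i = k" if "i \<le> n" "k \<le> n" for i k
    using inj_on_eq_iff[OF D(2)] that by auto
  have "inj_on x {Suc 0..<Suc (Suc n)}"
    by (rule inj_onI) (auto simp: x_def c_eq split: if_splits)
  then have "distinct (tl (awalk_verts (x 0) p))"
    using p(2) by (simp add: map_tl[symmetric] distinct_map del: upt_Suc)
  moreover have "x (Suc n) = x 0" by (simp add: x_def)
  ultimately have "cycle p" using p(1) len unfolding cycle_def by force
  have ends: "arc_to_ends G ` set p = (\<lambda>k. (x k, x (Suc k))) ` {..n}"
    using arg_cong[OF p(3), of set] by (simp add: lessThan_Suc_atMost atLeast0LessThan del: upt_Suc)
  have "tail G ` set p = fst ` (arc_to_ends G ` set p)"
    by (simp add: image_image arc_to_ends_def)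
  also have "\<dots> = x ` {..n}" by (simp add: ends image_image)
  also have "\<dots> = verts G" using V by (simp add: x_def)
  finally have tails: "verts G = tail G ` set p" by simp
  have "arcs_ends G = (arc_to_ends G ` set p)\<^sup>s"
  proof
    show "(arc_to_ends G ` set p)\<^sup>s \<subseteq> arcs_ends G"
      using x_step graph_symmetric by (auto simp: symcl_def ends)
    have edge: "(c i, c k) \<in> arc_to_ends G ` set p \<or> (c k, c i) \<in> arc_to_ends G ` set p"
      if "i < k" "k \<le> n" "(c i, c k) \<in> arcs_ends G" for i k
    proof -
      \<comment> \<open>The closing edge is traversed from \<open>c n\<close> to \<open>c 0\<close>,
        so its ends appear in the opposite order.\<close>
      have "(c i, c k) = (x i, x (Suc i)) \<or> (c k, c i) = (x n, x (Suc n))"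
        using D(5)[OF that] that by (auto simp: x_def)
      then show ?thesis using that by (auto simp: ends)
    qed
    show "arcs_ends G \<subseteq> (arc_to_ends G ` set p)\<^sup>s"
    proof (rule subrelI)
      fix a b assume ab: "(a, b) \<in> arcs_ends G"
      then obtain i k where ik: "a = c i" "b = c k" "i \<le> n" "k \<le> n"
        using arcs_ends_subset V by blast
      have "i \<noteq> k" using ab ik adj_not_same by metis
      then have "(a, b) \<in> arc_to_ends G ` set p \<or> (b, a) \<in> arc_to_ends G ` set p"
        using edge[of i k] edge[of k i] ab ik graph_symmetric by (metis linorder_neqE_nat)
      then show "(a, b) \<in> (arc_to_ends G ` set p)\<^sup>s" by (force simp: symcl_def)
    qed
  qed
  then show ?thesis
    unfolding cycle_digraph_def using \<open>graph G\<close> \<open>cycle p\<close> len tails D(1) by auto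
qed

theorem theorem5:
  fixes G :: "('a,'b) pre_digraph"
  assumes "Digraph.graph G"
    and "\<And>H. induced_subgraph H G \<Longrightarrow> Digraph_Component.connected H \<Longrightarrow> geodetic H"
    and "block B G"
  shows "(\<exists>n. complete_digraph n B) \<or> (\<exists>n. odd n \<and> cycle_digraph n B)"
proof -
  note B = block_imp_induced[OF assms(1,3)]
  interpret B: graph B by (rule B(1))
  have conn: "connected_on (arcs_ends B) (verts B)"
    using B(2) B.connected_iff_connected_on by blast
  interpret hereditarily_geodetic_block "verts B" "arcs_ends B"
  proof
    show "finite (verts B)" by simp
    show "sym (arcs_ends B)" using B.sym_arcs by (simp add: symmetric_def)
    show "irrefl (arcs_ends B)" using B.adj_not_same by (auto simp: irrefl_def)
    show "arcs_ends B \<subseteq> verts B \<times> verts B" by (rule B.arcs_ends_subset)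
    show "connected_on (arcs_ends B) (verts B)" by (rule conn)
    show "connected_on (arcs_ends B) (verts B - {c})" if "c \<in> verts B" for c
      using B.no_cut_vertex_iff[OF conn] B(3) that by blast
    show "unique_geodesics_on (arcs_ends B) S"
      if S: "S \<subseteq> verts B" "connected_on (arcs_ends B) S" for S
    proof (cases "S = {}")
      case True
      then show ?thesis using unique_geodesics_on_empty by simp
    next
      case False
      interpret S: graph "B \<restriction> S" by (rule B.graph_induce[OF S(1)])
      \<comment> \<open>Here it matters that \<open>B\<close> itself is induced in \<open>G\<close>:
        only then does the assumption on \<open>G\<close> reach \<open>S\<close>.\<close>
      have "induced_subgraph (B \<restriction> S) G"
        by (rule induced_subgraph_trans[OF B.induced_induce[OF S(1)] B(4)])
      moreover have "Digraph_Component.connected (B \<restriction> S)"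
        using S False S.connected_iff_connected_on
        by (simp add: arcs_ends_induce connected_on_restrict)
      ultimately have "geodetic (B \<restriction> S)" by (rule assms(2))
      then show ?thesis
        using S.unique_geodesics_on_if_geodetic unique_geodesics_on_restrict
        by (simp add: arcs_ends_induce)
    qed
  qed
  from complete_or_odd_cycle show ?thesis
  proof
    assume "\<forall>x\<in>verts B. \<forall>y\<in>verts B. x \<noteq> y \<longrightarrow> (x, y) \<in> arcs_ends B"
    then have "arcs_ends B = {(u, v). (u, v) \<in> verts B \<times> verts B \<and> u \<noteq> v}"
      using E_V by (auto dest: E_neq)
    then show ?thesis using B(1) by (auto simp: complete_digraph_def)
  next
    assume "\<exists>c n. even n \<and> induced_cycle (arcs_ends B) c n \<and> c ` {..n} = verts B"
    then obtain n where "even n" "cycle_digraph (Suc n) B"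
      using induced_cycle_imp_cycle_digraph[OF B(1)] by blast
    then have "odd (Suc n) \<and> cycle_digraph (Suc n) B" by simp
    then show ?thesis by blast
  qed
qed

end
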